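(* There exists a convex subset $C$ of $\ell^2$ of first category in $\ell^2$ such that $C^{\ddagger}=\ell^2$.
   Context: $\ell^2$ is the real Hilbert space of square summable real sequences. First category means a countable union of nowhere dense subsets of $\ell^2$. For a subset $C$ of a vector space $X$, $C^{\ddagger}:=\bigcup_{\dim Z<\infty}\overline{C\cap Z}$, where $Z$ runs over the finite dimensional vector subspaces of $X$ and the closure of $C\cap Z$ is relative to the Euclidean topology of $Z$. *)

theory Defs
  imports "HOL-Analysis.Analysis"
begin

section \<open>The real Hilbert space of square summable sequences\<close>

typedef ell2 = "{f :: nat \<Rightarrow> real. summable (\<lambda>n. (f n)\<^sup>2)}"
  morphisms ell2_nth Abs_ell2
  by (rule exI[of _ "\<lambda>_. 0"]) simp

setup_lifting type_definition_ell2

lemma summable_mult_of_squares: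
  fixes f g :: "nat \<Rightarrow> real"
  assumes "summable (\<lambda>n. (f n)\<^sup>2)" "summable (\<lambda>n. (g n)\<^sup>2)"
  shows "summable (\<lambda>n. f n * g n)"
proof (rule summable_comparison_test)
  have "\<bar>f n * g n\<bar> \<le> (f n)\<^sup>2 + (g n)\<^sup>2" for n
  proof -
    have "0 \<le> (f n + g n)\<^sup>2 + (f n - g n)\<^sup>2 + (f n)\<^sup>2 + (g n)\<^sup>2"
      and "0 \<le> (\<bar>f n\<bar> - \<bar>g n\<bar>)\<^sup>2" by simp_all
    then have "2 * (\<bar>f n\<bar> * \<bar>g n\<bar>) \<le> (f n)\<^sup>2 + (g n)\<^sup>2"
      by (simp add: power2_diff)
    moreover have "0 \<le> (f n)\<^sup>2 + (g n)\<^sup>2" by simp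
    ultimately show ?thesis unfolding abs_mult by linarith
  qed
  then show "\<exists>N. \<forall>n\<ge>N. norm (f n * g n) \<le> (f n)\<^sup>2 + (g n)\<^sup>2" by simp
  show "summable (\<lambda>n. (f n)\<^sup>2 + (g n)\<^sup>2)" using assms by (rule summable_add)
qed

lemma square_summable_add:
  fixes f g :: "nat \<Rightarrow> real"
  assumes "summable (\<lambda>n. (f n)\<^sup>2)" "summable (\<lambda>n. (g n)\<^sup>2)"
  shows "summable (\<lambda>n. (f n + g n)\<^sup>2)"
proof -
  have "summable (\<lambda>n. (f n)\<^sup>2 + (g n)\<^sup>2 + 2 * (f n * g n))"
    using assms summable_mult_of_squares[OF assms]
    by (intro summable_add summable_mult)
  then show ?thesis by (simp add: power2_sum mult.assoc)
qed

lemma square_summable_scale: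
  fixes f :: "nat \<Rightarrow> real"
  shows "summable (\<lambda>n. (f n)\<^sup>2) \<Longrightarrow> summable (\<lambda>n. (r * f n)\<^sup>2)"
  by (simp add: power_mult_distrib summable_mult)

instantiation ell2 :: real_vector
begin

lift_definition zero_ell2 :: ell2 is "\<lambda>_. 0" by simp
lift_definition uminus_ell2 :: "ell2 \<Rightarrow> ell2" is "\<lambda>f n. - f n" by simp
lift_definition plus_ell2 :: "ell2 \<Rightarrow> ell2 \<Rightarrow> ell2" is "\<lambda>f g n. f n + g n"
  by (rule square_summable_add)
lift_definition minus_ell2 :: "ell2 \<Rightarrow> ell2 \<Rightarrow> ell2" is "\<lambda>f g n. f n - g n"
  using square_summable_add[of _ "\<lambda>n. - _ n"] by simp
lift_definition scaleR_ell2 :: "real \<Rightarrow> ell2 \<Rightarrow> ell2" is "\<lambda>r f n. r * f n"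
  by (rule square_summable_scale)

instance
  by standard (transfer; simp add: algebra_simps fun_eq_iff)+

end

instantiation ell2 :: real_inner
begin

lift_definition inner_ell2 :: "ell2 \<Rightarrow> ell2 \<Rightarrow> real" is "\<lambda>f g. \<Sum>n. f n * g n" .

definition norm_ell2 :: "ell2 \<Rightarrow> real" where "norm_ell2 x = sqrt (inner x x)"
definition sgn_ell2 :: "ell2 \<Rightarrow> ell2" where "sgn_ell2 x = x /\<^sub>R norm x"
definition dist_ell2 :: "ell2 \<Rightarrow> ell2 \<Rightarrow> real" where "dist_ell2 x y = norm (x - y)"
definition uniformity_ell2 :: "(ell2 \<times> ell2) filter"
  where "uniformity_ell2 = (INF e\<in>{0 <..}. principal {(x :: ell2, y). dist x y < e})"
definition open_ell2 :: "ell2 set \<Rightarrow> bool"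
  where "open_ell2 U = (\<forall>x\<in>U. \<forall>\<^sub>F (x', y) in uniformity. x' = x \<longrightarrow> y \<in> U)"

instance
proof
  fix x y z :: ell2 and r :: real
  show "inner x y = inner y x"
    by transfer (simp add: mult.commute)
  show "inner (x + y) z = inner x z + inner y z"
    by transfer (simp add: distrib_right suminf_add[symmetric] summable_mult_of_squares)
  show "inner (r *\<^sub>R x) y = r * inner x y"
    by transfer (simp add: mult.assoc suminf_mult[symmetric] summable_mult_of_squares)
  show "0 \<le> inner x x"
    by transfer (rule suminf_nonneg; simp add: power2_eq_square)
  show "(inner x x = 0) = (x = 0)"
    by transfer (subst suminf_eq_zero_iff; simp add: power2_eq_square fun_eq_iff)
qed (simp_all add: norm_ell2_def sgn_ell2_def dist_ell2_def uniformity_ell2_def open_ell2_def)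

end

lemma norm_ell2_power2: "(norm x)\<^sup>2 = (\<Sum>n. (ell2_nth x n)\<^sup>2)" for x :: ell2
  unfolding power2_norm_eq_inner by transfer (simp add: power2_eq_square)

lemma sum_le_norm_ell2_power2: "(\<Sum>n<N. (ell2_nth x n)\<^sup>2) \<le> (norm x)\<^sup>2" for x :: ell2
  unfolding norm_ell2_power2 using ell2_nth[of x] by (intro sum_le_suminf) auto

lemma abs_ell2_nth_le_norm: "\<bar>ell2_nth x n\<bar> \<le> norm x" for x :: ell2
proof -
  have "(ell2_nth x n)\<^sup>2 \<le> (\<Sum>i<Suc n. (ell2_nth x i)\<^sup>2)"
    by (rule member_le_sum) auto
  also have "\<dots> \<le> (norm x)\<^sup>2" by (rule sum_le_norm_ell2_power2)
  finally show ?thesis by (simp add: abs_le_square_iff[symmetric])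
qed

instance ell2 :: complete_space
proof
  fix X :: "nat \<Rightarrow> ell2"
  assume "Cauchy X"
  have "Cauchy (\<lambda>k. ell2_nth (X k) n)" for n
  proof (rule metric_CauchyI)
    fix e :: real assume "0 < e"
    then obtain M where M: "\<And>j k. j \<ge> M \<Longrightarrow> k \<ge> M \<Longrightarrow> norm (X j - X k) < e"
      using \<open>Cauchy X\<close> unfolding Cauchy_def dist_norm by blast
    have "dist (ell2_nth (X j) n) (ell2_nth (X k) n) < e" if "j \<ge> M" "k \<ge> M" for j k
      using abs_ell2_nth_le_norm[of "X j - X k" n] M[OF that]
      by (simp add: dist_real_def minus_ell2.rep_eq)
    then show "\<exists>M. \<forall>j\<ge>M. \<forall>k\<ge>M. dist (ell2_nth (X j) n) (ell2_nth (X k) n) < e" by blast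
  qed
  then have "\<exists>l. (\<lambda>k. ell2_nth (X k) n) \<longlonglongrightarrow> l" for n
    unfolding Cauchy_convergent_iff convergent_def by blast
  then obtain f where f: "\<And>n. (\<lambda>k. ell2_nth (X k) n) \<longlonglongrightarrow> f n" by metis
  have bound: "summable (\<lambda>n. (ell2_nth (X k) n - f n)\<^sup>2) \<and>
      (\<Sum>n. (ell2_nth (X k) n - f n)\<^sup>2) \<le> e\<^sup>2"
    if e: "\<And>j. j \<ge> M \<Longrightarrow> norm (X k - X j) < e" for k M e
  proof -
    have partial: "(\<Sum>n<N. (ell2_nth (X k) n - f n)\<^sup>2) \<le> e\<^sup>2" for N
    proof (rule tendsto_upperbound)
      show "(\<lambda>j. \<Sum>n<N. (ell2_nth (X k) n - ell2_nth (X j) n)\<^sup>2)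
          \<longlonglongrightarrow> (\<Sum>n<N. (ell2_nth (X k) n - f n)\<^sup>2)"
        by (intro tendsto_intros f)
      have "(\<Sum>n<N. (ell2_nth (X k) n - ell2_nth (X j) n)\<^sup>2) \<le> e\<^sup>2" if "j \<ge> M" for j
      proof -
        have "(\<Sum>n<N. (ell2_nth (X k) n - ell2_nth (X j) n)\<^sup>2) \<le> (norm (X k - X j))\<^sup>2"
          using sum_le_norm_ell2_power2[where x = "X k - X j" and N = N]
          by (simp add: minus_ell2.rep_eq)
        also have "\<dots> \<le> e\<^sup>2" using e[OF that] by (intro power_mono) auto
        finally show ?thesis .
      qed
      then show "\<forall>\<^sub>F j in sequentially.
          (\<Sum>n<N. (ell2_nth (X k) n - ell2_nth (X j) n)\<^sup>2) \<le> e\<^sup>2"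
        unfolding eventually_sequentially by blast
    qed simp
    then have "summable (\<lambda>n. (ell2_nth (X k) n - f n)\<^sup>2)"
      by (intro summableI_nonneg_bounded) auto
    then show ?thesis using partial by (auto intro: suminf_le_const)
  qed
  obtain M where "\<And>j k. j \<ge> M \<Longrightarrow> k \<ge> M \<Longrightarrow> norm (X j - X k) < 1"
    using \<open>Cauchy X\<close> unfolding Cauchy_def dist_norm using zero_less_one by blast
  then have "summable (\<lambda>n. (ell2_nth (X M) n - f n)\<^sup>2)" using bound[of M M 1] by simp
  then have "summable (\<lambda>n. (-1 * (ell2_nth (X M) n - f n))\<^sup>2)"
    by (rule square_summable_scale)
  then have "summable (\<lambda>n. (ell2_nth (X M) n + -1 * (ell2_nth (X M) n - f n))\<^sup>2)"
    using ell2_nth[of "X M"] by (intro square_summable_add) auto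
  then have "summable (\<lambda>n. (f n)\<^sup>2)" by simp
  then have nth: "ell2_nth (Abs_ell2 f) = f" by (simp add: Abs_ell2_inverse)
  have "X \<longlonglongrightarrow> Abs_ell2 f"
  proof (rule metric_LIMSEQ_I)
    fix r :: real assume "0 < r"
    then have "0 < r / 2" by simp
    then obtain M where M: "\<And>j k. j \<ge> M \<Longrightarrow> k \<ge> M \<Longrightarrow> norm (X j - X k) < r / 2"
      using \<open>Cauchy X\<close> unfolding Cauchy_def dist_norm by blast
    have "dist (X k) (Abs_ell2 f) < r" if "k \<ge> M" for k
    proof -
      have "(norm (X k - Abs_ell2 f))\<^sup>2 \<le> (r / 2)\<^sup>2"
        using bound[of M k "r / 2"] M that by (simp add: norm_ell2_power2 minus_ell2.rep_eq nth)
      then have "norm (X k - Abs_ell2 f) \<le> r / 2"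
        using \<open>0 < r\<close> by (simp add: power2_le_iff_abs_le)
      then show ?thesis using \<open>0 < r\<close> by (simp add: dist_norm)
    qed
    then show "\<exists>M. \<forall>k\<ge>M. dist (X k) (Abs_ell2 f) < r" by blast
  qed
  then show "convergent X" unfolding convergent_def by blast
qed


section \<open>First category\<close>

definition nowhere_dense :: "'a::topological_space set \<Rightarrow> bool"
  where "nowhere_dense S \<longleftrightarrow> interior (closure S) = {}"

definition first_category :: "'a::topological_space set \<Rightarrow> bool"
  where "first_category S \<longleftrightarrow> (\<exists>\<N>. countable \<N> \<and> (\<forall>N\<in>\<N>. nowhere_dense N) \<and> S = \<Union>\<N>)"


section \<open>The set \<open>C\<close> with double dagger\<close>

text \<open>The library's \<^const>\<open>dim\<close> is \<open>0\<close> on infinite dimensional subspaces, so it cannot be used to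
  express finite dimensionality.\<close>

definition finite_dim_subspace :: "'a::real_vector set \<Rightarrow> bool"
  where "finite_dim_subspace Z \<longleftrightarrow> subspace Z \<and> (\<exists>B. finite B \<and> span B = Z)"

text \<open>The topology on \<open>span B\<close>, for a finite independent set \<open>B\<close>, that makes the coordinate map
  onto the space of real functions on \<open>B\<close> a homeomorphism.\<close>

definition coordinate_topology :: "'a::real_vector set \<Rightarrow> 'a topology"
  where "coordinate_topology B =
    pullback_topology (span B) (\<lambda>x. \<lambda>b\<in>B. representation B x b)
      (product_topology (\<lambda>_. euclideanreal) B)"

text \<open>The choice of the basis is immaterial, see \<open>euclidean_topology_on_eq\<close> below.\<close>

definition euclidean_topology_on :: "'a::real_vector set \<Rightarrow> 'a topology"
  where "euclidean_topology_on Z =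
    coordinate_topology (SOME B. finite B \<and> independent B \<and> span B = Z)"

definition ddagger :: "'a::real_vector set \<Rightarrow> 'a set"  (\<open>(_\<^sup>\<ddagger>)\<close> [1000] 1000)
  where "C\<^sup>\<ddagger> = (\<Union>Z\<in>{Z. finite_dim_subspace Z}. euclidean_topology_on Z closure_of (C \<inter> Z))"

lemma topspace_coordinate_topology [simp]: "topspace (coordinate_topology B) = span B"
  by (auto simp: coordinate_topology_def topspace_pullback_topology)

lemma openin_coordinate_topology_change_basis:
  fixes B B' :: "'a::real_vector set"
  assumes B: "finite B" "independent B" and B': "finite B'" "independent B'"
    and eq: "span B = span B'" and U: "openin (coordinate_topology B) U"
  shows "openin (coordinate_topology B') U"
proof -
  let ?P = "\<lambda>B :: 'a set. product_topology (\<lambda>_. euclideanreal) B"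
  let ?f = "\<lambda>B x. \<lambda>b\<in>B :: 'a set. representation B x b"
  define h where "h = (\<lambda>y. \<lambda>b\<in>B. \<Sum>c\<in>B'. y c * representation B c b)"
  have h: "continuous_map (?P B') (?P B) h"
    unfolding h_def continuous_map_componentwise
    by (auto intro!: continuous_map_sum continuous_map_real_mult continuous_map_product_projection B')
  have fB: "?f B x = (h \<circ> ?f B') x" if x: "x \<in> span B'" for x
  proof -
    have "representation B x b = (\<Sum>c\<in>B'. representation B' x c * representation B c b)" for b
    proof -
      have "representation B x b = representation B (\<Sum>c\<in>B'. representation B' x c *\<^sub>R c) b"
        using sum_representation_eq[OF B'(2) x B'(1) order_refl] by simp
      also have "\<dots> = (\<Sum>c\<in>B'. representation B (representation B' x c *\<^sub>R c) b)"
        using eq by (subst representation_sum[OF B(2)]) (auto intro: span_scale span_base)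
      also have "\<dots> = (\<Sum>c\<in>B'. representation B' x c * representation B c b)"
        using eq by (intro sum.cong refl) (simp add: representation_scale[OF B(2)] span_base)
      finally show ?thesis .
    qed
    then show ?thesis by (auto simp: h_def fun_eq_iff intro!: sum.cong)
  qed
  have "continuous_map (coordinate_topology B') (?P B) (h \<circ> ?f B')"
    unfolding coordinate_topology_def by (rule continuous_map_pullback[OF h])
  then have "continuous_map (coordinate_topology B') (?P B) (?f B)"
    by (rule continuous_map_eq) (simp add: fB)
  then have "continuous_map (coordinate_topology B') (coordinate_topology B) id"
    unfolding coordinate_topology_def[of B]
    by (intro continuous_map_pullback') (auto simp: eq)
  from openin_continuous_map_preimage[OF this U] openin_subset[OF U] show ?thesis
    by (simp add: eq Int_absorb1 flip: Int_def)
qed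

lemma euclidean_topology_on_eq:
  assumes "finite B" "independent B" "span B = Z"
  shows "euclidean_topology_on Z = coordinate_topology B"
proof -
  let ?B = "SOME B. finite B \<and> independent B \<and> span B = Z"
  have "finite ?B \<and> independent ?B \<and> span ?B = Z"
    by (rule someI[of _ B]) (use assms in blast)
  then show ?thesis unfolding euclidean_topology_on_def topology_eq
    using assms openin_coordinate_topology_change_basis[of B ?B]
      openin_coordinate_topology_change_basis[of ?B B] by metis
qed

end

theory Submission
  imports Defs
begin

text \<open>
  The set \<open>C\<close> consists of the square summable sequences that are eventually nonnegative.

  It is of first category because it is the union, over \<open>N\<close>, of the closed sets of sequences that
  are nonnegative from index \<open>N\<close> on: the coordinates of a point of \<open>\<ell>\<^sup>2\<close> tend to \<open>0\<close>, so
  an arbitrarily small change of a single late coordinate leads out of such a set.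

  It satisfies \<open>C\<^sup>\<ddagger> = \<ell>\<^sup>2\<close> because there is no slowest convergent series: every
  \<open>x \<in> \<ell>\<^sup>2\<close> is dominated by some \<open>y \<in> \<ell>\<^sup>2\<close> in the sense that \<open>x\<^sub>n = o(y\<^sub>n)\<close>
  (lemma \<open>ell2_dominated\<close>). Then \<open>x + t y\<close> is eventually nonnegative for every \<open>t > 0\<close>, so \<open>x\<close> is
  the limit of points of \<open>C\<close> within the at most two-dimensional span of \<open>x\<close> and \<open>y\<close>.
\<close>

text \<open>The classical choice is \<open>b n = a n / sqrt (r n)\<close> with the tails \<open>r n\<close> of the series. Since
  \<open>a n = r n - r (Suc n)\<close>, factoring the difference of squares bounds \<open>b n\<close> by twice the
  increment of \<open>sqrt \<circ> r\<close>, and these increments telescope.\<close>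

lemma summable_dominated:
  fixes a :: "nat \<Rightarrow> real"
  assumes sum: "summable a" and nonneg: "\<And>n. 0 \<le> a n"
  obtains b where "summable b" "\<And>n. 0 \<le> b n"
    "\<And>e. 0 < e \<Longrightarrow> \<forall>\<^sub>F n in sequentially. a n \<le> e * b n"
proof -
  define r where "r n = (\<Sum>k. a (k + n))" for n
  define b where "b n = a n / sqrt (r n)" for n
  have r_nonneg: "0 \<le> r n" for n
    unfolding r_def using sum nonneg by (intro suminf_nonneg) simp_all
  have r_eq: "r n = suminf a - sum a {..<n}" for n
    unfolding r_def by (rule suminf_minus_initial_segment[OF sum])
  have a_eq: "a n = r n - r (Suc n)" for n
    by (simp add: r_eq)
  have a_le: "a n \<le> r n" for n
    using a_eq[of n] r_nonneg[of "Suc n"] by simp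
  have "(\<lambda>n. suminf a - sum a {..<n}) \<longlonglongrightarrow> suminf a - suminf a"
    by (intro tendsto_intros summable_LIMSEQ sum)
  then have "r \<longlonglongrightarrow> 0"
    by (simp flip: r_eq)
  then have sqrt_r: "(\<lambda>n. sqrt (r n)) \<longlonglongrightarrow> 0"
    using tendsto_real_sqrt[of r 0] by simp
  have b_nonneg: "0 \<le> b n" for n
    by (simp add: b_def nonneg r_nonneg)
  have b_le: "b n \<le> 2 * (sqrt (r n) - sqrt (r (Suc n)))" for n
  proof (cases "r n = 0")
    case True
    then have "a n = 0" "r (Suc n) = 0"
      using a_le[of n] nonneg[of n] a_eq[of n] by simp_all
    then show ?thesis by (simp add: b_def True)
  next
    case False
    define u v where "u = sqrt (r n)" and "v = sqrt (r (Suc n))"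
    have "0 < u" "v \<le> u"
      using False r_nonneg[of n] a_eq[of n] nonneg[of n] by (simp_all add: u_def v_def)
    have "a n = (u - v) * (u + v)"
      using a_eq[of n] r_nonneg[of n] r_nonneg[of "Suc n"]
      by (simp add: u_def v_def algebra_simps)
    also have "\<dots> \<le> (u - v) * (2 * u)"
      using \<open>v \<le> u\<close> by (intro mult_left_mono) simp_all
    finally show ?thesis
      using \<open>0 < u\<close> by (simp add: b_def field_simps flip: u_def v_def)
  qed
  have "summable (\<lambda>n. 2 * (sqrt (r n) - sqrt (r (Suc n))))"
    by (intro summable_mult telescope_summable'[OF sqrt_r])
  then have "summable b"
    by (rule summable_comparison_test'[where N = 0]) (use b_nonneg b_le in auto)
  moreover have "\<forall>\<^sub>F n in sequentially. a n \<le> e * b n" if "0 < e" for e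
    using order_tendstoD(2)[OF sqrt_r that]
  proof eventually_elim
    case (elim n)
    show ?case
    proof (cases "r n = 0")
      case True
      then have "a n \<le> 0" using a_le[of n] by simp
      also have "0 \<le> e * b n" using b_nonneg[of n] \<open>0 < e\<close> by simp
      finally show ?thesis .
    next
      case False
      then have "0 < sqrt (r n)" using r_nonneg[of n] by simp
      moreover have "a n * sqrt (r n) \<le> a n * e"
        using elim nonneg[of n] by (intro mult_left_mono) simp_all
      ultimately show ?thesis by (simp add: b_def field_simps)
    qed
  qed
  ultimately show thesis using that b_nonneg by blast
qed

lemma ell2_dominated:
  fixes x :: ell2
  obtains y :: ell2 where
    "\<And>t. 0 < t \<Longrightarrow> \<forall>\<^sub>F n in sequentially. \<bar>ell2_nth x n\<bar> \<le> t * ell2_nth y n"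
proof -
  have "summable (\<lambda>n. (ell2_nth x n)\<^sup>2)" using ell2_nth[of x] by simp
  then obtain b where b: "summable b" "\<And>n. 0 \<le> b n"
    "\<And>e. 0 < e \<Longrightarrow> \<forall>\<^sub>F n in sequentially. (ell2_nth x n)\<^sup>2 \<le> e * b n"
    by (rule summable_dominated) auto
  define y where "y = Abs_ell2 (\<lambda>n. sqrt (b n))"
  have y: "ell2_nth y n = sqrt (b n)" for n
    using b(1,2) by (simp add: y_def Abs_ell2_inverse)
  have "\<forall>\<^sub>F n in sequentially. \<bar>ell2_nth x n\<bar> \<le> t * ell2_nth y n" if "0 < t" for t
    using b(3)[of "t\<^sup>2"] that
  proof (simp, elim eventually_mono)
    fix n assume "(ell2_nth x n)\<^sup>2 \<le> t\<^sup>2 * b n"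
    then have "sqrt ((ell2_nth x n)\<^sup>2) \<le> sqrt (t\<^sup>2 * b n)"
      by (rule real_sqrt_le_mono)
    then show "\<bar>ell2_nth x n\<bar> \<le> t * ell2_nth y n"
      using that by (simp add: y real_sqrt_mult)
  qed
  then show thesis by (rule that)
qed

text \<open>Affine maps into a finite dimensional subspace are continuous for its Euclidean topology
  because their coordinates are affine; so the endpoint \<open>x\<close> of the open ray lies in the closure.\<close>

lemma ddagger_if_open_ray_subset:
  fixes x y :: "'a::real_vector"
  assumes ray: "\<And>t::real. 0 < t \<Longrightarrow> x + t *\<^sub>R y \<in> C"
  shows "x \<in> C\<^sup>\<ddagger>"
proof -
  define Z where "Z = span {x, y}"
  obtain B where B: "B \<subseteq> {x, y}" "independent B" "{x, y} \<subseteq> span B"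
    by (rule maximal_independent_subset)
  have span_B: "span B = Z"
    unfolding Z_def using B(1,3) by (meson span_mono span_minimal subspace_span subset_antisym)
  have "finite B" using B(1) by (rule finite_subset) simp
  have xy: "x \<in> span B" "y \<in> span B"
    using B(3) by simp_all
  let ?f = "\<lambda>t. x + t *\<^sub>R y"
  have in_Z: "?f t \<in> Z" for t
    by (simp add: Z_def span_add span_base span_scale)
  have coord: "representation B (?f t) b = representation B x b + t * representation B y b" for t b
    using xy by (simp add: representation_add[OF B(2)] representation_scale[OF B(2)] span_scale)
  have "continuous_map euclideanreal (product_topology (\<lambda>_. euclideanreal) B)
      ((\<lambda>z. \<lambda>b\<in>B. representation B z b) \<circ> ?f)"
    unfolding continuous_map_componentwise
    by (auto simp: coord intro!: continuous_intros)
  then have "continuous_map euclideanreal (coordinate_topology B) ?f"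
    unfolding coordinate_topology_def
    using in_Z by (intro continuous_map_pullback') (auto simp: span_B)
  then have "continuous_map euclideanreal (euclidean_topology_on Z) ?f"
    by (simp add: euclidean_topology_on_eq[OF \<open>finite B\<close> B(2) span_B])
  then have "?f ` closure {0<..} \<subseteq> euclidean_topology_on Z closure_of (?f ` {0<..})"
    using continuous_map_image_closure_subset by fastforce
  also have "\<dots> \<subseteq> euclidean_topology_on Z closure_of (C \<inter> Z)"
    by (rule closure_of_mono) (use ray in_Z in auto)
  finally have "?f ` {0..} \<subseteq> euclidean_topology_on Z closure_of (C \<inter> Z)"
    by simp
  moreover have "x \<in> ?f ` {0..}" by (rule image_eqI[of _ _ 0]) simp_all
  moreover have "finite_dim_subspace Z"
    unfolding finite_dim_subspace_def using \<open>finite B\<close> span_B by auto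
  ultimately show ?thesis unfolding ddagger_def by blast
qed

lemma continuous_on_ell2_nth: "continuous_on UNIV (\<lambda>x. ell2_nth x n)"
proof (rule bounded_linear.continuous_on[OF _ continuous_on_id])
  show "bounded_linear (\<lambda>x. ell2_nth x n)"
    by (rule bounded_linear_intro[where K = 1])
      (simp_all add: plus_ell2.rep_eq scaleR_ell2.rep_eq abs_ell2_nth_le_norm)
qed

lift_definition ell2_unit :: "nat \<Rightarrow> ell2" is "\<lambda>m n. if n = m then 1 else 0"
  by (rule summable_finite[of "{_}"]) simp_all

lemma norm_ell2_unit: "norm (ell2_unit m) = 1"
proof -
  have "(norm (ell2_unit m))\<^sup>2 = (\<Sum>n. if n = m then 1 else 0)"
    unfolding norm_ell2_power2 ell2_unit.rep_eq by (rule suminf_cong) simp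
  also have "\<dots> = 1"
    by (subst suminf_finite[of "{m}"]) simp_all
  finally show ?thesis by (simp add: power2_eq_iff_nonneg[of _ 1, simplified])
qed

text \<open>The coordinates of a point tend to \<open>0\<close>, so subtracting a small multiple of a unit vector of
  large index makes one of them negative.\<close>

lemma nowhere_dense_nonneg_from:
  "nowhere_dense {x. \<forall>n\<ge>N. 0 \<le> ell2_nth x n}" (is "nowhere_dense ?P")
proof -
  have "?P = (\<Inter>n\<in>{N..}. {x. 0 \<le> ell2_nth x n})" by auto
  then have "closed ?P"
    by (auto intro!: closed_INT closed_Collect_le continuous_on_const continuous_on_ell2_nth)
  moreover have "x \<notin> interior ?P" for x
  proof
    assume "x \<in> interior ?P"
    then obtain e where e: "0 < e" "ball x e \<subseteq> ?P"
      by (auto simp: mem_interior)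
    have "summable (\<lambda>n. (ell2_nth x n)\<^sup>2)" using ell2_nth[of x] by simp
    from summable_LIMSEQ_zero[OF this] have "(\<lambda>n. ell2_nth x n) \<longlonglongrightarrow> 0"
      by (simp add: power_tendsto_0_iff)
    from order_tendstoD(2)[OF this, of "e / 2"] e(1)
    obtain m where m: "m \<ge> N" "ell2_nth x m < e / 2"
      unfolding eventually_sequentially by (metis half_gt_zero linear)
    let ?z = "x - (e / 2) *\<^sub>R ell2_unit m"
    have "?z \<in> ball x e"
      using e(1) by (simp add: dist_norm norm_ell2_unit)
    then have "0 \<le> ell2_nth ?z m" using e(2) m(1) by blast
    then show False
      using m(2) by (simp add: minus_ell2.rep_eq scaleR_ell2.rep_eq ell2_unit.rep_eq)
  qed
  ultimately show ?thesis unfolding nowhere_dense_def by auto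
qed

theorem mainTheorem15:
  shows "\<exists>C :: ell2 set. convex C \<and> first_category C \<and> C\<^sup>\<ddagger> = UNIV"
proof (intro exI conjI)
  let ?C = "{x :: ell2. \<forall>\<^sub>F n in sequentially. 0 \<le> ell2_nth x n}"
  show "convex ?C"
  proof (rule convexI, simp)
    fix x y :: ell2 and u v :: real
    assume uv: "0 \<le> u" "0 \<le> v"
      and "\<forall>\<^sub>F n in sequentially. 0 \<le> ell2_nth x n" "\<forall>\<^sub>F n in sequentially. 0 \<le> ell2_nth y n"
    from this(3,4) show "\<forall>\<^sub>F n in sequentially. 0 \<le> ell2_nth (u *\<^sub>R x + v *\<^sub>R y) n"
      by eventually_elim (simp add: uv plus_ell2.rep_eq scaleR_ell2.rep_eq)
  qed
  let ?P = "\<lambda>N. {x. \<forall>n\<ge>N. 0 \<le> ell2_nth x n}"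
  have "?C = \<Union>(range ?P)"
    by (auto simp: eventually_sequentially)
  then show "first_category ?C"
    unfolding first_category_def
    by (intro exI[of _ "range ?P"]) (auto intro: nowhere_dense_nonneg_from)
  have "x \<in> ?C\<^sup>\<ddagger>" for x
  proof -
    obtain y where y: "\<And>t. 0 < t \<Longrightarrow> \<forall>\<^sub>F n in sequentially. \<bar>ell2_nth x n\<bar> \<le> t * ell2_nth y n"
      using ell2_dominated[of x] by blast
    show ?thesis
    proof (rule ddagger_if_open_ray_subset, simp)
      fix t :: real assume "0 < t"
      from y[OF this] show "\<forall>\<^sub>F n in sequentially. 0 \<le> ell2_nth (x + t *\<^sub>R y) n"
        by eventually_elim (simp add: plus_ell2.rep_eq scaleR_ell2.rep_eq)
    qed
  qed
  then show "?C\<^sup>\<ddagger> = UNIV" by blast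
qed

end
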